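(* Let $X$ be a simplicial complex with $\Omega=|X|$ and $I=[0,1]$. Let $K$ be an admissible product complex of $\Omega\times I$ and let $E:C_k(X)\to C_{k+1}(K)$, $k\ge0$, be linear maps with $\partial E+E\partial=(j_1)_\#-(j_0)_\#$. Suppose $X$ is discrete contractible, with discrete contraction $\Psi:K\to X$ to the vertex $a\in X^0$. Define $\mathrm{Co}:C_k(X)\to C_{k+1}(X)$, $k\ge0$, by $\mathrm{Co}(\sigma)=(\Psi_\#\circ E)(\sigma)$ for $\sigma\in X^k$. Then $\mathrm{Co}$ is a simplicial cone operator with contraction vertex $a$; that is, $\mathrm{Co}(\partial_k\sigma)+\partial_{k+1}\mathrm{Co}(\sigma)=\sigma$ for all $\sigma\in X^k$, $k\ge1$, and $\partial_1\mathrm{Co}(v)=v-a$ for all $v\in X^0$.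
   Context: $X^k$ is the set of $k$-simplices of $X$; $C_k(\cdot)$ denotes real simplicial $k$-chains and $\partial$ the boundary map ($\partial=0$ on $0$-chains). A simplicial map $f:X\to Y$ induces $f_\#:C_k(X)\to C_k(Y)$ by $f_\#[v_0,\dots,v_k]=[f(v_0),\dots,f(v_k)]$ if the $f(v_i)$ are distinct and $0$ otherwise. A simplicial complex $K$ is an admissible product complex of $\Omega\times I$ if (1) $|K|=\Omega\times I$; (2) for every simplex $\sigma\in X$, $\sigma\times I$ is the underlying space of a subcomplex of $K$; (3) for every $\sigma\in X$, $\sigma\times\{0\}$ and $\sigma\times\{1\}$ are simplices of $K$. The simplicial maps $j_0,j_1:X\to K$ are induced by $v\mapsto(v,0)$ and $v\mapsto(v,1)$ on vertices. A discrete contraction (to a vertex $a\in X^0$) is a simplicial map $\Psi:K\to X$ with $\Psi(\cdot,0)=\pi$ and $\Psi(\cdot,1)=\mathrm{id}_X$, where $\pi:X\to[a]$ is the simplicial map sending every vertex to $a$. $X$ is discrete contractible if such a map exists. *)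

theory Defs
  imports "HOL-Analysis.Analysis" "HOL-Analysis.Finite_Function_Topology"
begin

section \<open>Real oriented chains\<close>

definition lin_extend :: "('k \<Rightarrow> 'b::real_vector) \<Rightarrow> ('k \<Rightarrow>\<^sub>0 real) \<Rightarrow> 'b"
  where "lin_extend g p = (\<Sum>x\<in>Poly_Mapping.keys p. Poly_Mapping.lookup p x *\<^sub>R g x)"

lemma lin_extend_superset:
  assumes "finite A" "Poly_Mapping.keys p \<subseteq> A"
  shows "lin_extend g p = (\<Sum>x\<in>A. Poly_Mapping.lookup p x *\<^sub>R g x)"
  unfolding lin_extend_def
  by (rule sum.mono_neutral_left) (use assms in \<open>auto simp: in_keys_iff\<close>)

lemma lookup_scaleR_poly_mapping:
  "Poly_Mapping.lookup (r *\<^sub>R p) x = r * Poly_Mapping.lookup p x"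
  for p :: "'k \<Rightarrow>\<^sub>0 real"
  by (simp add: scaleR_poly_mapping_def)

lemma linear_lin_extend: "linear (lin_extend g)"
proof (rule linearI)
  fix p q :: "'a \<Rightarrow>\<^sub>0 real"
  let ?A = "Poly_Mapping.keys p \<union> Poly_Mapping.keys q"
  have "lin_extend g (p + q) = (\<Sum>x\<in>?A. Poly_Mapping.lookup (p + q) x *\<^sub>R g x)"
    by (rule lin_extend_superset) (auto simp: in_keys_iff lookup_add)
  moreover have "lin_extend g p = (\<Sum>x\<in>?A. Poly_Mapping.lookup p x *\<^sub>R g x)"
    by (rule lin_extend_superset) auto
  moreover have "lin_extend g q = (\<Sum>x\<in>?A. Poly_Mapping.lookup q x *\<^sub>R g x)"
    by (rule lin_extend_superset) auto
  ultimately show "lin_extend g (p + q) = lin_extend g p + lin_extend g q"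
    by (simp add: lookup_add scaleR_left_distrib sum.distrib)
next
  fix r :: real and p :: "'a \<Rightarrow>\<^sub>0 real"
  have "lin_extend g (r *\<^sub>R p) = (\<Sum>x\<in>Poly_Mapping.keys p. Poly_Mapping.lookup (r *\<^sub>R p) x *\<^sub>R g x)"
    by (rule lin_extend_superset) (auto simp: in_keys_iff lookup_scaleR_poly_mapping)
  then show "lin_extend g (r *\<^sub>R p) = r *\<^sub>R lin_extend g p"
    by (simp add: lin_extend_def scaleR_sum_right lookup_scaleR_poly_mapping)
qed

lemma lin_extend_single: "lin_extend g (Poly_Mapping.single x r) = r *\<^sub>R g x"
  by (cases "r = 0") (simp_all add: lin_extend_def)

text \<open>
  Formal combinations of ordered simplices are taken modulo
  \<open>[\<dots>, u, v, \<dots>] = - [\<dots>, v, u, \<dots>]\<close>.  Adjacent transpositions generate all permutations, so this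
  is the relation \<open>[v\<^bsub>\<pi> 0\<^esub>, \<dots>, v\<^bsub>\<pi> k\<^esub>] = sgn \<pi> [v\<^sub>0, \<dots>, v\<^sub>k]\<close>; a list with a repeated vertex
  becomes \<open>0\<close>.
\<close>

definition orientation_relations :: "('v list \<Rightarrow>\<^sub>0 real) set"
  where "orientation_relations =
    span {Poly_Mapping.single (xs @ [u, v] @ ys) 1 + Poly_Mapping.single (xs @ [v, u] @ ys) 1
          | xs u v ys. True}"

lemma subspace_orientation_relations: "subspace orientation_relations"
  unfolding orientation_relations_def by (rule subspace_span)

lemma zero_in_orientation_relations: "0 \<in> orientation_relations"
  unfolding orientation_relations_def by (rule span_zero)

quotient_type 'v chain =
  "'v list \<Rightarrow>\<^sub>0 real" / "\<lambda>p q. p - q \<in> orientation_relations"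
proof (rule equivpI)
  show "reflp (\<lambda>p q. p - q \<in> orientation_relations)"
    by (auto intro!: reflpI simp: zero_in_orientation_relations)
  show "symp (\<lambda>p q. p - q \<in> orientation_relations)"
  proof (rule sympI)
    fix p q :: "'a list \<Rightarrow>\<^sub>0 real"
    assume "p - q \<in> orientation_relations"
    then have "- (p - q) \<in> orientation_relations"
      unfolding orientation_relations_def by (rule span_neg)
    then show "q - p \<in> orientation_relations" by simp
  qed
  show "transp (\<lambda>p q. p - q \<in> orientation_relations)"
  proof (rule transpI)
    fix p q r :: "'a list \<Rightarrow>\<^sub>0 real"
    assume "p - q \<in> orientation_relations" "q - r \<in> orientation_relations"
    then have "(p - q) + (q - r) \<in> orientation_relations"
      unfolding orientation_relations_def by (rule span_add)
    then show "p - r \<in> orientation_relations" by simp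
  qed
qed

instantiation chain :: (type) real_vector
begin

lift_definition zero_chain :: "'a chain" is 0 .

lift_definition plus_chain :: "'a chain \<Rightarrow> 'a chain \<Rightarrow> 'a chain" is "(+)"
proof -
  fix p q r s :: "'a list \<Rightarrow>\<^sub>0 real"
  assume "p - q \<in> orientation_relations" "r - s \<in> orientation_relations"
  then have "(p - q) + (r - s) \<in> orientation_relations"
    unfolding orientation_relations_def by (rule span_add)
  then show "(p + r) - (q + s) \<in> orientation_relations"
    by (simp only: add_diff_add)
qed

lift_definition uminus_chain :: "'a chain \<Rightarrow> 'a chain" is "uminus"
proof -
  fix p q :: "'a list \<Rightarrow>\<^sub>0 real"
  assume "p - q \<in> orientation_relations"
  then have "- (p - q) \<in> orientation_relations"
    unfolding orientation_relations_def by (rule span_neg)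
  then show "- p - - q \<in> orientation_relations"
    by (simp only: minus_diff_minus)
qed

lift_definition minus_chain :: "'a chain \<Rightarrow> 'a chain \<Rightarrow> 'a chain" is "(-)"
proof -
  fix p q r s :: "'a list \<Rightarrow>\<^sub>0 real"
  assume "p - q \<in> orientation_relations" "r - s \<in> orientation_relations"
  then have "(p - q) - (r - s) \<in> orientation_relations"
    unfolding orientation_relations_def by (rule span_diff)
  then show "(p - r) - (q - s) \<in> orientation_relations"
    by (simp only: diff_conv_add_uminus minus_add_distrib minus_minus ac_simps)
qed

lift_definition scaleR_chain :: "real \<Rightarrow> 'a chain \<Rightarrow> 'a chain" is "scaleR"
proof -
  fix c :: real and p q :: "'a list \<Rightarrow>\<^sub>0 real"
  assume "p - q \<in> orientation_relations"
  then have "c *\<^sub>R (p - q) \<in> orientation_relations"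
    unfolding orientation_relations_def by (rule span_mul)
  then show "c *\<^sub>R p - c *\<^sub>R q \<in> orientation_relations"
    by (simp only: scaleR_diff_right)
qed

instance
proof
  fix a b c :: "'a chain" and x y :: real
  show "a + b + c = a + (b + c)"
    by transfer (simp add: zero_in_orientation_relations add.assoc)
  show "a + b = b + a"
    by transfer (simp add: zero_in_orientation_relations add.commute)
  show "0 + a = a"
    by transfer (simp add: zero_in_orientation_relations)
  show "- a + a = 0"
    by transfer (simp add: zero_in_orientation_relations)
  show "a - b = a + - b"
    by transfer (simp add: zero_in_orientation_relations)
  show "x *\<^sub>R (a + b) = x *\<^sub>R a + x *\<^sub>R b"
    by transfer (simp add: zero_in_orientation_relations scaleR_right_distrib)
  show "(x + y) *\<^sub>R a = x *\<^sub>R a + y *\<^sub>R a"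
    by transfer (simp add: zero_in_orientation_relations scaleR_left_distrib)
  show "x *\<^sub>R y *\<^sub>R a = (x * y) *\<^sub>R a"
    by transfer (simp add: zero_in_orientation_relations)
  show "1 *\<^sub>R a = a"
    by transfer (simp add: zero_in_orientation_relations)
qed

end

text \<open>The oriented simplex \<open>[v\<^sub>0, \<dots>, v\<^sub>k]\<close>.\<close>

lift_definition oriented_simplex :: "'v list \<Rightarrow> 'v chain"
  is "\<lambda>vs. Poly_Mapping.single vs 1" .

lemma lin_extend_orientation_relations:
  assumes "p - q \<in> orientation_relations"
    and "\<And>xs u v ys. g (xs @ [u, v] @ ys) + g (xs @ [v, u] @ ys) \<in> S"
    and "subspace S"
  shows "lin_extend g p - lin_extend g q \<in> S"
proof -
  have "lin_extend g ` orientation_relations \<subseteq> S"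
    unfolding orientation_relations_def
      linear_span_image[OF linear_lin_extend, symmetric]
    by (rule span_minimal)
       (use assms(2,3) in \<open>auto simp: linear_add[OF linear_lin_extend] lin_extend_single\<close>)
  then show ?thesis
    using assms(1) by (metis image_subset_iff linear_diff[OF linear_lin_extend])
qed

lemma orientation_relation_swap:
  "Poly_Mapping.single (xs @ [u, v] @ ys) 1 + Poly_Mapping.single (xs @ [v, u] @ ys) 1
     \<in> orientation_relations"
  unfolding orientation_relations_def by (rule span_base) blast

definition delete_nth :: "nat \<Rightarrow> 'v list \<Rightarrow> 'v list"
  where "delete_nth i vs = take i vs @ drop (Suc i) vs"

definition list_boundary :: "'v list \<Rightarrow> 'v list \<Rightarrow>\<^sub>0 real"
  where "list_boundary vs =
    (if length vs \<le> 1 then 0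
     else \<Sum>i<length vs. (-1) ^ i *\<^sub>R Poly_Mapping.single (delete_nth i vs) 1)"

lemma list_boundary_swap:
  "list_boundary (xs @ [u, v] @ ys) + list_boundary (xs @ [v, u] @ ys) \<in> orientation_relations"
proof -
  let ?s = "\<lambda>l. Poly_Mapping.single l (1::real)"
  let ?n = "length xs" and ?m = "length ys"
  note sub = subspace_orientation_relations
  have split: "(\<Sum>i<?n + 2 + m. F i) =
      (\<Sum>i<?n. F i) + F ?n + F (Suc ?n) + (\<Sum>i<m. F (?n + 2 + i))"
    for F :: "nat \<Rightarrow> 'a list \<Rightarrow>\<^sub>0 real" and m
    by (induction m) (simp_all add: add.assoc)
  let ?T = "\<lambda>u v i. (-1) ^ i *\<^sub>R ?s (delete_nth i (xs @ [u, v] @ ys))"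
  have len: "length (xs @ [a, b] @ ys) = ?n + 2 + ?m" for a b by simp
  have bd: "list_boundary (xs @ [a, b] @ ys) = (\<Sum>i<?n + 2 + ?m. ?T a b i)" for a b
    unfolding list_boundary_def len by simp
  have lo: "?T u v i + ?T v u i \<in> orientation_relations" if "i < ?n" for i
  proof -
    have "?T u v i + ?T v u i =
        (-1) ^ i *\<^sub>R (?s (delete_nth i xs @ [u, v] @ ys) + ?s (delete_nth i xs @ [v, u] @ ys))"
      using that by (simp add: delete_nth_def scaleR_right_distrib)
    then show ?thesis
      using orientation_relation_swap subspace_scale[OF sub] by metis
  qed
  have hi: "?T u v (?n + 2 + i) + ?T v u (?n + 2 + i) \<in> orientation_relations" for i
  proof -
    have "?T u v (?n + 2 + i) + ?T v u (?n + 2 + i) = (-1) ^ (?n + 2 + i) *\<^sub>R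
        (?s (xs @ [u, v] @ delete_nth i ys) + ?s (xs @ [v, u] @ delete_nth i ys))"
      by (simp add: delete_nth_def scaleR_right_distrib eval_nat_numeral)
    then show ?thesis
      using orientation_relation_swap subspace_scale[OF sub] by metis
  qed
  have mid: "?T u v ?n + ?T u v (Suc ?n) + (?T v u ?n + ?T v u (Suc ?n)) = 0"
    by (simp add: delete_nth_def)
  have "list_boundary (xs @ [u, v] @ ys) + list_boundary (xs @ [v, u] @ ys) =
      (\<Sum>i<?n. ?T u v i + ?T v u i) + (\<Sum>i<?m. ?T u v (?n + 2 + i) + ?T v u (?n + 2 + i))
      + (?T u v ?n + ?T u v (Suc ?n) + (?T v u ?n + ?T v u (Suc ?n)))"
    unfolding bd split sum.distrib by (simp only: ac_simps)
  also have "\<dots> \<in> orientation_relations"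
    unfolding mid add_0_right
    by (rule subspace_add[OF sub]; rule subspace_sum[OF sub]; rule lo hi; simp)
  finally show ?thesis .
qed

text \<open>
  The boundary map in all degrees at once:
  \<open>\<partial>[v\<^sub>0, \<dots>, v\<^sub>k] = \<Sum>i\<le>k. (-1)\<^sup>i [\<dots>, v\<^bsub>i-1\<^esub>, v\<^bsub>i+1\<^esub>, \<dots>]\<close> for \<open>k \<ge> 1\<close>, and \<open>\<partial>[v] = 0\<close>.
\<close>

lift_definition boundary :: "'v chain \<Rightarrow> 'v chain" is "lin_extend list_boundary"
  by (rule lin_extend_orientation_relations)
     (assumption, rule list_boundary_swap, rule subspace_orientation_relations)

definition list_image :: "('v \<Rightarrow> 'w) \<Rightarrow> 'v list \<Rightarrow> 'w list \<Rightarrow>\<^sub>0 real"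
  where "list_image f vs =
    (if distinct (map f vs) then Poly_Mapping.single (map f vs) 1 else 0)"

text \<open>The induced map \<open>f\<^sub>#\<close> on chains.\<close>

lift_definition pushforward :: "('v \<Rightarrow> 'w) \<Rightarrow> 'v chain \<Rightarrow> 'w chain"
  is "\<lambda>f. lin_extend (list_image f)"
proof (rule lin_extend_orientation_relations)
  fix f :: "'v \<Rightarrow> 'w" and xs u v ys
  show "list_image f (xs @ [u, v] @ ys) + list_image f (xs @ [v, u] @ ys) \<in> orientation_relations"
  proof (cases "distinct (map f (xs @ [u, v] @ ys))")
    case True
    moreover from True have "distinct (map f (xs @ [v, u] @ ys))" by auto
    ultimately show ?thesis
      using orientation_relation_swap[of "map f xs" "f u" "f v" "map f ys"]
      by (simp add: list_image_def)
  next
    case False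
    moreover from False have "\<not> distinct (map f (xs @ [v, u] @ ys))" by auto
    ultimately show ?thesis
      by (simp only: list_image_def if_False) (simp add: zero_in_orientation_relations)
  qed
qed (assumption, rule subspace_orientation_relations)

lemma oriented_simplex_swap:
  "oriented_simplex (xs @ [u, v] @ ys) = - oriented_simplex (xs @ [v, u] @ ys)"
proof -
  have "oriented_simplex (xs @ [u, v] @ ys) + oriented_simplex (xs @ [v, u] @ ys) = 0"
    by transfer (simp only: orientation_relation_swap diff_zero)
  then show ?thesis by (simp only: eq_neg_iff_add_eq_0)
qed

lemma linear_boundary: "linear boundary"
  by (rule linearI; transfer)
     (simp_all add: linear_add[OF linear_lin_extend] linear_scale[OF linear_lin_extend]
        zero_in_orientation_relations)

lemma linear_pushforward: "linear (pushforward f)"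
  by (rule linearI; transfer)
     (simp_all add: linear_add[OF linear_lin_extend] linear_scale[OF linear_lin_extend]
        zero_in_orientation_relations)

lemma pushforward_oriented_simplex:
  "pushforward f (oriented_simplex vs) =
    (if distinct (map f vs) then oriented_simplex (map f vs) else 0)"
  by transfer (simp add: lin_extend_single list_image_def zero_in_orientation_relations)

lemma linear_abs_chain: "linear abs_chain"
  by (rule linearI) (simp_all add: plus_chain.abs_eq scaleR_chain.abs_eq)

lemma boundary_oriented_simplex:
  "boundary (oriented_simplex vs) =
    (if length vs \<le> 1 then 0
     else \<Sum>i<length vs. (-1) ^ i *\<^sub>R oriented_simplex (delete_nth i vs))"
proof -
  have "boundary (oriented_simplex vs) = abs_chain (list_boundary vs)"
    by (simp add: oriented_simplex.abs_eq boundary.abs_eq lin_extend_single)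
  then show ?thesis
    by (simp add: list_boundary_def linear_0[OF linear_abs_chain]
        linear_sum[OF linear_abs_chain] linear_scale[OF linear_abs_chain]
        oriented_simplex.abs_eq)
qed

lemma oriented_simplex_repeated: "\<not> distinct vs \<Longrightarrow> oriented_simplex vs = 0"
proof -
  have adj: "oriented_simplex (xs @ [u, u] @ ys) = 0" for xs ys and u :: 'a
  proof -
    let ?c = "oriented_simplex (xs @ [u, u] @ ys)"
    have "2 *\<^sub>R ?c = 0"
      using oriented_simplex_swap[of xs u u ys] by (metis add.right_inverse scaleR_2)
    then show ?thesis by simp
  qed
  have "oriented_simplex (xs @ [u] @ ms @ [u] @ ys) = 0" for xs ms ys and u :: 'a
  proof (induction ms arbitrary: xs)
    case Nil
    then show ?case using adj[of xs u ys] by simp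
  next
    case (Cons m ms)
    then show ?case
      using oriented_simplex_swap[of xs u m "ms @ [u] @ ys"] Cons.IH[of "xs @ [m]"] by simp
  qed
  then show "\<not> distinct vs \<Longrightarrow> oriented_simplex vs = 0"
    using not_distinct_decomp by blast
qed

text \<open>The relations do not annihilate any simplex with distinct vertices.\<close>

fun inversions :: "nat list \<Rightarrow> nat"
  where "inversions [] = 0"
  | "inversions (x # xs) = length (filter (\<lambda>y. y < x) xs) + inversions xs"

lemma inversions_swap:
  "u < v \<Longrightarrow> inversions (xs @ [v, u] @ ys) = Suc (inversions (xs @ [u, v] @ ys))"
  by (induction xs) auto

lemma oriented_simplex_nonzero:
  assumes "distinct vs"
  shows "oriented_simplex vs \<noteq> 0"
proof
  assume "oriented_simplex vs = 0"
  then have mem: "Poly_Mapping.single vs 1 - 0 \<in> (orientation_relations :: ('a list \<Rightarrow>\<^sub>0 real) set)"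
    by transfer
  define idx where "idx = inv_into {..<length vs} ((!) vs)"
  have inj: "inj_on ((!) vs) {..<length vs}"
    using assms by (simp add: inj_on_nth)
  have idx: "idx u \<noteq> idx v" if "u \<in> set vs" "v \<in> set vs" "u \<noteq> v" for u v
    using that unfolding idx_def
    by (metis (no_types, opaque_lifting) f_inv_into_f imageI in_set_conv_nth lessThan_iff)
  define g :: "'a list \<Rightarrow> real"
    where "g ws = (if distinct ws \<and> set ws = set vs then (-1) ^ inversions (map idx ws) else 0)" for ws
  have "g (xs @ [u, v] @ ys) + g (xs @ [v, u] @ ys) \<in> {0}" for xs u v ys
  proof (cases "distinct (xs @ [u, v] @ ys) \<and> set (xs @ [u, v] @ ys) = set vs")
    case True
    then have "idx u < idx v \<or> idx v < idx u"
      using idx[of u v] by (auto simp: neq_iff[symmetric])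
    then have "(-1::real) ^ inversions (map idx (xs @ [u, v] @ ys)) =
        - ((-1) ^ inversions (map idx (xs @ [v, u] @ ys)))"
      using inversions_swap[of "idx u" "idx v" "map idx xs" "map idx ys"]
        inversions_swap[of "idx v" "idx u" "map idx xs" "map idx ys"] by auto
    moreover have "distinct (xs @ [v, u] @ ys) \<and> set (xs @ [v, u] @ ys) = set vs"
      using True by auto
    ultimately show ?thesis
      using True by (simp add: g_def)
  next
    case False
    moreover from this have "\<not> (distinct (xs @ [v, u] @ ys) \<and> set (xs @ [v, u] @ ys) = set vs)"
      by auto
    ultimately show ?thesis by (simp only: g_def) simp
  qed
  then have "lin_extend g (Poly_Mapping.single vs 1) - lin_extend g 0 \<in> {0}"
    by (rule lin_extend_orientation_relations[OF mem]) simp_all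
  then show False
    using assms by (simp add: lin_extend_single g_def linear_0[OF linear_lin_extend])
qed

section \<open>Geometric simplicial complexes\<close>

text \<open>
  \<^const>\<open>simplicial_complex\<close> without its finiteness requirement.  As there, the empty simplex is a
  face and hence a member of every nonempty complex; it carries no chains below.
\<close>

definition geometric_complex :: "'a::euclidean_space set set \<Rightarrow> bool"
  where "geometric_complex X \<longleftrightarrow>
    (\<forall>S\<in>X. \<exists>n. n simplex S) \<and>
    (\<forall>F S. S \<in> X \<and> F face_of S \<longrightarrow> F \<in> X) \<and>
    (\<forall>S S'. S \<in> X \<and> S' \<in> X \<longrightarrow> (S \<inter> S') face_of S)"

lemma simplicial_complex_iff_geometric_complex:
  "simplicial_complex X \<longleftrightarrow> finite X \<and> geometric_complex X"
  by (auto simp: simplicial_complex_def geometric_complex_def)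

definition vertices :: "'a::euclidean_space set set \<Rightarrow> 'a set"
  where "vertices X = {v. {v} \<in> X}"

text \<open>The vertex sets of the simplices of \<open>X\<close>.\<close>

definition vertex_scheme :: "'a::euclidean_space set set \<Rightarrow> 'a set set"
  where "vertex_scheme X = {V. \<not> affine_dependent V \<and> convex hull V \<in> X}"

text \<open>The \<open>k\<close>-simplices of \<open>X\<close>, each with every ordering of its vertices.\<close>

definition ordered_simplices :: "nat \<Rightarrow> 'a::euclidean_space set set \<Rightarrow> 'a list set"
  where "ordered_simplices k X =
    {vs. length vs = Suc k \<and> distinct vs \<and> set vs \<in> vertex_scheme X}"

definition simplicial_chains :: "nat \<Rightarrow> 'a::euclidean_space set set \<Rightarrow> 'a chain set"
  where "simplicial_chains k X = span (oriented_simplex ` ordered_simplices k X)"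

text \<open>Simplicial maps are given by their vertex maps; only the values on \<open>vertices X\<close> matter.\<close>

definition simplicial_map ::
    "'a::euclidean_space set set \<Rightarrow> 'b::euclidean_space set set \<Rightarrow> ('a \<Rightarrow> 'b) \<Rightarrow> bool"
  where "simplicial_map X Y f \<longleftrightarrow> (\<forall>V\<in>vertex_scheme X. f ` V \<in> vertex_scheme Y)"

definition linear_between ::
    "'b::real_vector set \<Rightarrow> 'c::real_vector set \<Rightarrow> ('b \<Rightarrow> 'c) \<Rightarrow> bool"
  where "linear_between A B f \<longleftrightarrow>
    f ` A \<subseteq> B \<and>
    (\<forall>x\<in>A. \<forall>y\<in>A. f (x + y) = f x + f y) \<and>
    (\<forall>r. \<forall>x\<in>A. f (r *\<^sub>R x) = r *\<^sub>R f x)"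

section \<open>Product complexes, discrete contractions and cone operators\<close>

definition admissible_product_complex ::
    "'a::euclidean_space set set \<Rightarrow> ('a \<times> real) set set \<Rightarrow> bool"
  where "admissible_product_complex X K \<longleftrightarrow>
    geometric_complex K \<and>
    \<Union>K = \<Union>X \<times> {0..1} \<and>
    (\<forall>\<sigma>\<in>X. \<exists>L\<subseteq>K. geometric_complex L \<and> \<Union>L = \<sigma> \<times> {0..1}) \<and>
    (\<forall>\<sigma>\<in>X. \<sigma> \<times> {0} \<in> K \<and> \<sigma> \<times> {1} \<in> K)"

definition j0 :: "'a \<Rightarrow> 'a \<times> real" where "j0 v = (v, 0)"

definition j1 :: "'a \<Rightarrow> 'a \<times> real" where "j1 v = (v, 1)"

text \<open>
  \<open>\<Psi>(\<cdot>, 0) = \<pi>\<close> and \<open>\<Psi>(\<cdot>, 1) = id\<close> are equalities of simplicial maps on \<open>X\<close>, i.e. of vertex maps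
  on \<open>vertices X\<close>; \<open>\<pi>\<close> is constantly \<open>a\<close>.
\<close>

definition discrete_contraction ::
    "'a::euclidean_space set set \<Rightarrow> ('a \<times> real) set set \<Rightarrow> 'a \<Rightarrow> ('a \<times> real \<Rightarrow> 'a) \<Rightarrow> bool"
  where "discrete_contraction X K a \<Psi> \<longleftrightarrow>
    a \<in> vertices X \<and> simplicial_map K X \<Psi> \<and>
    (\<forall>v\<in>vertices X. \<Psi> (j0 v) = a) \<and>
    (\<forall>v\<in>vertices X. \<Psi> (j1 v) = v)"

definition simplicial_cone_operator ::
    "'a::euclidean_space set set \<Rightarrow> 'a \<Rightarrow> (nat \<Rightarrow> 'a chain \<Rightarrow> 'a chain) \<Rightarrow> bool"
  where "simplicial_cone_operator X a Co \<longleftrightarrow>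
    (\<forall>k. linear_between (simplicial_chains k X) (simplicial_chains (Suc k) X) (Co k)) \<and>
    (\<forall>k. \<forall>vs\<in>ordered_simplices (Suc k) X.
       Co k (boundary (oriented_simplex vs)) + boundary (Co (Suc k) (oriented_simplex vs))
         = oriented_simplex vs) \<and>
    (\<forall>v\<in>vertices X.
       boundary (Co 0 (oriented_simplex [v])) = oriented_simplex [v] - oriented_simplex [a])"

end

(*
  Pushforwards compose and commute with the boundary, because degenerate simplices are 0 in
  the chain space: the convention "0 if two images coincide" is then automatic, and f_# just maps f
  over the list of vertices.  Applying Psi_# to dE + Ed = (j_1)_# - (j_0)_# turns the right-hand
  side into id - pi_#, and pi_# kills every simplex of positive dimension since it collapses all its
  vertices to a, while it sends each vertex to a.
*)
theory Submission
  imports Defs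
begin

lemma pushforward_oriented_simplex_map:
  "pushforward f (oriented_simplex vs) = oriented_simplex (map f vs)"
  by (simp add: pushforward_oriented_simplex oriented_simplex_repeated)

text \<open>A finitely supported function is the sum of its point masses weighted by its values.
  This lets linear maps out of the free space be evaluated termwise.\<close>

lemma lin_extend_singles: "lin_extend (\<lambda>x. Poly_Mapping.single x 1) p = p"
proof (rule poly_mapping_eqI)
  fix y
  \<comment> \<open>The index set \<open>A\<close> is decoupled from the support of
    \<open>p\<close>, so that induction on \<open>A\<close> leaves the coefficients fixed.\<close>
  have "Poly_Mapping.lookup (\<Sum>x\<in>A. Poly_Mapping.lookup p x *\<^sub>R Poly_Mapping.single x 1) y
      = (if y \<in> A then Poly_Mapping.lookup p y else 0)" if "finite A" for A
    using that
    by induction (auto simp: lookup_add lookup_scaleR_poly_mapping lookup_single when_def)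
  then show "Poly_Mapping.lookup (lin_extend (\<lambda>x. Poly_Mapping.single x 1) p) y
      = Poly_Mapping.lookup p y"
    by (auto simp: lin_extend_def in_keys_iff)
qed

text \<open>Any representative is a finite combination of point masses, and the linear quotient map
  \<open>abs_chain\<close> sends these to oriented simplices.\<close>

lemma chain_in_span_oriented_simplices: "c \<in> span (range oriented_simplex)"
proof (induction c rule: chain.abs_induct)
  case (1 p)
  have "abs_chain p = (\<Sum>vs\<in>Poly_Mapping.keys p. Poly_Mapping.lookup p vs *\<^sub>R oriented_simplex vs)"
    by (subst lin_extend_singles[symmetric])
       (simp add: lin_extend_def oriented_simplex.abs_eq linear_sum[OF linear_abs_chain]
         linear_scale[OF linear_abs_chain])
  then show ?case by (simp add: span_base span_scale span_sum)
qed

lemma linear_chain_eqI: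
  assumes "linear f" "linear g"
    and "\<And>vs. f (oriented_simplex vs) = g (oriented_simplex vs)"
  shows "f = g"
  by (rule ext, rule linear_eq_on[OF assms(1,2) chain_in_span_oriented_simplices]) (use assms(3) in auto)

text \<open>By linearity a single list suffices. Applying \<open>f\<close> entrywise preserves the
  length and commutes with deleting the \<open>i\<close>-th entry, so the two alternating sums agree
  term by term, degenerate faces included.\<close>

lemma boundary_pushforward: "boundary (pushforward f c) = pushforward f (boundary c)"
proof -
  have "boundary \<circ> pushforward f = pushforward f \<circ> boundary"
  proof (rule linear_chain_eqI)
    fix vs
    show "(boundary \<circ> pushforward f) (oriented_simplex vs)
        = (pushforward f \<circ> boundary) (oriented_simplex vs)"
      by (simp add: pushforward_oriented_simplex_map boundary_oriented_simplex
          linear_0[OF linear_pushforward] linear_sum[OF linear_pushforward]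
          linear_scale[OF linear_pushforward] delete_nth_def take_map drop_map)
  qed (intro linear_compose linear_pushforward linear_boundary)+
  then show ?thesis by (simp add: fun_eq_iff)
qed

text \<open>It suffices to check generators: a simplex on which \<open>f\<close> is injective keeps
  its dimension and lands in \<open>Y\<close>, and any other goes to \<open>0\<close>.\<close>

lemma pushforward_simplicial_chains:
  assumes "simplicial_map X Y f" "c \<in> simplicial_chains k X"
  shows "pushforward f c \<in> simplicial_chains k Y"
proof -
  have "pushforward f (oriented_simplex vs) \<in> simplicial_chains k Y"
    if "vs \<in> ordered_simplices k X" for vs
  proof (cases "distinct (map f vs)")
    case True
    then have "map f vs \<in> ordered_simplices k Y"
      using that assms(1) by (auto simp: ordered_simplices_def simplicial_map_def)
    then show ?thesis
      by (simp add: pushforward_oriented_simplex_map simplicial_chains_def span_base)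
  next
    case False
    then show ?thesis
      unfolding pushforward_oriented_simplex simplicial_chains_def by (simp add: span_zero)
  qed
  then have "pushforward f ` span (oriented_simplex ` ordered_simplices k X)
      \<subseteq> simplicial_chains k Y"
    unfolding linear_span_image[OF linear_pushforward, symmetric]
    by (intro span_minimal) (auto simp: simplicial_chains_def)
  then show ?thesis
    using assms(2) by (auto simp: simplicial_chains_def)
qed

text \<open>Each vertex of a simplex is one of its faces, and \<open>X\<close> is closed under
  faces. This is needed because a contraction prescribes \<open>\<Psi> \<circ> j0\<close> and
  \<open>\<Psi> \<circ> j1\<close> only on \<open>vertices X\<close>.\<close>

lemma ordered_simplex_vertices:
  assumes "geometric_complex X" "vs \<in> ordered_simplices k X"
  shows "set vs \<subseteq> vertices X"
proof
  fix v assume v: "v \<in> set vs"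
  have indep: "\<not> affine_dependent (set vs)" and hull: "convex hull set vs \<in> X"
    using assms(2) by (auto simp: ordered_simplices_def vertex_scheme_def)
  have "convex hull {v} face_of convex hull set vs"
    using v by (intro face_of_convex_hull_affine_independent[OF indep, THEN iffD2]) blast
  then show "v \<in> vertices X"
    using assms(1) hull by (auto simp: vertices_def geometric_complex_def)
qed

lemma vertex_ordered_simplex: "v \<in> vertices X \<Longrightarrow> [v] \<in> ordered_simplices 0 X"
  by (simp add: ordered_simplices_def vertex_scheme_def vertices_def)

theorem theorem5p7:
  fixes X :: "'a::euclidean_space set set"
    and K :: "('a \<times> real) set set"
    and E :: "nat \<Rightarrow> 'a chain \<Rightarrow> ('a \<times> real) chain"
    and \<Psi> :: "'a \<times> real \<Rightarrow> 'a"
    and a :: 'a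
  assumes "geometric_complex X"
    and "admissible_product_complex X K"
    and "\<And>k. linear_between (simplicial_chains k X) (simplicial_chains (Suc k) K) (E k)"
    and "\<And>c. c \<in> simplicial_chains 0 X \<Longrightarrow>
           boundary (E 0 c) = pushforward j1 c - pushforward j0 c"
    and "\<And>k c. c \<in> simplicial_chains (Suc k) X \<Longrightarrow>
           boundary (E (Suc k) c) + E k (boundary c) = pushforward j1 c - pushforward j0 c"
    and "discrete_contraction X K a \<Psi>"
  shows "simplicial_cone_operator X a (\<lambda>k. pushforward \<Psi> \<circ> E k)"
proof -
  note contraction = assms(6)[unfolded discrete_contraction_def]
  have \<Psi>: "simplicial_map K X \<Psi>"
    using contraction by blast
  have chain: "oriented_simplex vs \<in> simplicial_chains k X" if "vs \<in> ordered_simplices k X" for k vs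
    using that by (simp add: simplicial_chains_def span_base)
  \<comment> \<open>The list \<open>replicate (length vs) a\<close> is the image of
    \<open>vs\<close> under the constant map \<pi>.\<close>
  have ends: "pushforward \<Psi> (pushforward j1 (oriented_simplex vs) - pushforward j0 (oriented_simplex vs))
      = oriented_simplex vs - oriented_simplex (replicate (length vs) a)"
    if "set vs \<subseteq> vertices X" for vs
  proof -
    have "map (\<Psi> \<circ> j1) vs = vs"
      using that contraction by (intro map_idI) auto
    moreover have "map (\<Psi> \<circ> j0) vs = replicate (length vs) a"
      using that contraction by (subst map_replicate_const[symmetric]) (auto intro!: map_cong)
    ultimately show ?thesis
      by (simp only: linear_diff[OF linear_pushforward] pushforward_oriented_simplex_map map_map)
  qed
  show ?thesis
    unfolding simplicial_cone_operator_def o_def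
  proof (intro conjI allI ballI)
    fix k
    show "linear_between (simplicial_chains k X) (simplicial_chains (Suc k) X)
        (\<lambda>c. pushforward \<Psi> (E k c))"
      using assms(3)[of k] pushforward_simplicial_chains[OF \<Psi>]
      by (auto simp: linear_between_def image_subset_iff
          linear_add[OF linear_pushforward] linear_scale[OF linear_pushforward])
  next
    fix k vs
    assume vs: "vs \<in> ordered_simplices (Suc k) X"
    let ?c = "oriented_simplex vs"
    have "pushforward \<Psi> (E k (boundary ?c)) + boundary (pushforward \<Psi> (E (Suc k) ?c))
        = pushforward \<Psi> (boundary (E (Suc k) ?c) + E k (boundary ?c))"
      by (simp add: boundary_pushforward linear_add[OF linear_pushforward])
    also have "\<dots> = ?c - oriented_simplex (replicate (length vs) a)"
      by (simp only: assms(5)[OF chain[OF vs]] ends[OF ordered_simplex_vertices[OF assms(1) vs]])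
    \<comment> \<open>Here \<open>vs\<close> has \<open>k + 2\<close> entries, at least two, so
      \<open>a\<close> is repeated.\<close>
    also have "oriented_simplex (replicate (length vs) a) = 0"
      using vs by (intro oriented_simplex_repeated) (simp add: ordered_simplices_def)
    finally show "pushforward \<Psi> (E k (boundary ?c)) + boundary (pushforward \<Psi> (E (Suc k) ?c)) = ?c"
      by simp
  next
    fix v
    assume v: "v \<in> vertices X"
    then show "boundary (pushforward \<Psi> (E 0 (oriented_simplex [v])))
        = oriented_simplex [v] - oriented_simplex [a]"
      \<comment> \<open>In degree zero the replicated list is just \<open>[a]\<close>, which has no
        repetition, so this term survives.\<close>
      using ends[of "[v]"] assms(4)[OF chain[OF vertex_ordered_simplex[OF v]]]
      by (simp add: boundary_pushforward)
  qed
qed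

end
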